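(* Let $R$ be a commutative unital ring. Then: (1) The unitary $M$-stable rank has the stabilizing property: if $\operatorname{usr}R=n<\infty$ and $m\ge n$, then for every $(\boldsymbol f,g)\in U_{m+1}(R)$ there is $\boldsymbol u\in U_m(R)$ such that $\boldsymbol f+\boldsymbol u\,g\in U_m(R)$. (2) $\operatorname{bsr}R\le\operatorname{usr}R\le\operatorname{bsr}R+1$. Moreover, both cases in (2) can occur: there is a commutative unital ring $R$ with $\operatorname{bsr}R<\infty$ and $\operatorname{usr}R=\operatorname{bsr}R$, and there is a commutative unital ring $R$ with $\operatorname{bsr}R<\infty$ and $\operatorname{usr}R=\operatorname{bsr}R+1$.
   Context: For a commutative unital ring $R$ and an integer $n\ge 1$, let $U_n(R)=\{(f_1,\dots,f_n)\in R^n:\ \sum_{j=1}^n Rf_j=R\}$ be the set of invertible $n$-tuples. For $\boldsymbol f,\boldsymbol x\in R^n$ and $g\in R$, $\boldsymbol f+\boldsymbol x\,g$ means $(f_1+x_1g,\dots,f_n+x_ng)$. The following ranks take values in $\{1,2,3,\dots\}\cup\{\infty\}$; each is the smallest integer $n\ge 1$ with the stated property, and $\infty$ if there is no such $n$ (with $\infty+1=\infty$). - Bass stable rank $\operatorname{bsr}R$: for every $(\boldsymbol f,g)\in U_{n+1}(R)$ there is $\boldsymbol x\in R^n$ with $\boldsymbol f+\boldsymbol x\,g\in U_n(R)$. - Unitary $M$-stable rank $\operatorname{usr}R$: for every $(\boldsymbol f,g)\in U_{n+1}(R)$ there is $\boldsymbol u\in U_n(R)$ with $\boldsymbol f+\boldsymbol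 u\,g\in U_n(R)$. *)

theory Defs
  imports "HOL-Algebra.Ring" "HOL-Library.Extended_Nat"
begin

text \<open>
  Elements of \<open>R\<^sup>n\<close> are lists of length \<open>n\<close> over the carrier, so \<open>(f, g)\<close> with \<open>f \<in> R\<^sup>n\<close> and
  \<open>g \<in> R\<close> is \<open>f @ [g]\<close>. The zero ring is allowed, as in the locale \<open>cring\<close>.
\<close>

definition tuples :: "('a, 'm) ring_scheme \<Rightarrow> nat \<Rightarrow> 'a list set" where
  "tuples R n = {f. length f = n \<and> set f \<subseteq> carrier R}"

definition ideal_sum :: "('a, 'm) ring_scheme \<Rightarrow> 'a list \<Rightarrow> 'a set" where
  "ideal_sum R f =
    {(\<Oplus>\<^bsub>R\<^esub>j\<in>{..<length f}. (r ! j) \<otimes>\<^bsub>R\<^esub> (f ! j)) | r. r \<in> tuples R (length f)}"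

definition inv_tuples :: "('a, 'm) ring_scheme \<Rightarrow> nat \<Rightarrow> 'a list set" where
  "inv_tuples R n = {f \<in> tuples R n. ideal_sum R f = carrier R}"

definition add_mult :: "('a, 'm) ring_scheme \<Rightarrow> 'a list \<Rightarrow> 'a list \<Rightarrow> 'a \<Rightarrow> 'a list" where
  "add_mult R f x g = map2 (\<lambda>a b. a \<oplus>\<^bsub>R\<^esub> b \<otimes>\<^bsub>R\<^esub> g) f x"

definition least_rank :: "(nat \<Rightarrow> bool) \<Rightarrow> enat" where
  "least_rank P = (if \<exists>n\<ge>1. P n then enat (LEAST n. 1 \<le> n \<and> P n) else \<infinity>)"

definition bsr :: "('a, 'm) ring_scheme \<Rightarrow> enat" where
  "bsr R = least_rank (\<lambda>n. \<forall>f g. f @ [g] \<in> inv_tuples R (n + 1) \<longrightarrow>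
     (\<exists>x\<in>tuples R n. add_mult R f x g \<in> inv_tuples R n))"

definition usr :: "('a, 'm) ring_scheme \<Rightarrow> enat" where
  "usr R = least_rank (\<lambda>n. \<forall>f g. f @ [g] \<in> inv_tuples R (n + 1) \<longrightarrow>
     (\<exists>u\<in>inv_tuples R n. add_mult R f u g \<in> inv_tuples R n))"

end

theory Submission
  imports Defs "HOL-Number_Theory.Residues"
begin

text \<open>
  Let \<open>(f\<^sub>1, \<dots>, f\<^sub>n, p, g)\<close> be invertible, say \<open>\<Sum> r\<^sub>j f\<^sub>j + h = 1\<close> with \<open>h = a p + b g\<close>, and put
  \<open>F = p + g\<close>, so that \<open>h = a F + (b - a) g\<close>. If the Bass condition holds for \<open>n\<close>, it gives \<open>y\<close> with
  \<open>f + y h\<close> invertible; reducing modulo \<open>F\<close>, the tuple \<open>(f + y (b - a) g, F)\<close> is invertible. It equals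
  \<open>(f, p) + u g\<close> with \<open>u = (y (b - a), 1)\<close>, which is invertible because its last entry is \<open>1\<close>. So the
  Bass condition for \<open>n\<close> implies the unitary condition for \<open>n + 1\<close>, which yields both (1) and (2).
  A field has Bass stable rank 1, and its unitary stable rank is 1 unless the field is \<open>{0, 1}\<close>,
  where \<open>1 + u 1 = 0\<close> for the only unit \<open>u = 1\<close>. Hence the fields with 3 and 2 elements are the
  required examples.
\<close>

section \<open>Stability conditions at a fixed length, and least ranks\<close>

definition bass_at :: "('a, 'm) ring_scheme \<Rightarrow> nat \<Rightarrow> bool" where
  "bass_at R n \<longleftrightarrow> (\<forall>f g. f @ [g] \<in> inv_tuples R (n + 1) \<longrightarrow>
     (\<exists>x\<in>tuples R n. add_mult R f x g \<in> inv_tuples R n))"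

definition unitary_at :: "('a, 'm) ring_scheme \<Rightarrow> nat \<Rightarrow> bool" where
  "unitary_at R n \<longleftrightarrow> (\<forall>f g. f @ [g] \<in> inv_tuples R (n + 1) \<longrightarrow>
     (\<exists>u\<in>inv_tuples R n. add_mult R f u g \<in> inv_tuples R n))"

text \<open>The elements of \<open>ideal_sum R f\<close> are the values \<open>dot R r f\<close>, so
  a coefficient list \<open>r\<close> with value \<one> certifies invertibility. The index range
  comes from the second argument only.\<close>

definition dot :: "('a, 'm) ring_scheme \<Rightarrow> 'a list \<Rightarrow> 'a list \<Rightarrow> 'a" where
  "dot R r f = (\<Oplus>\<^bsub>R\<^esub>j\<in>{..<length f}. (r ! j) \<otimes>\<^bsub>R\<^esub> (f ! j))"

lemma bsr_eq: "bsr R = least_rank (bass_at R)"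
  unfolding bsr_def bass_at_def ..

lemma usr_eq: "usr R = least_rank (unitary_at R)"
  unfolding usr_def unitary_at_def ..

lemma least_rank_eq_enatD:
  assumes "least_rank P = enat n"
  shows "1 \<le> n" "P n"
  using assms LeastI_ex[of "\<lambda>n. 1 \<le> n \<and> P n"]
  by (auto simp: least_rank_def split: if_splits)

lemma least_rank_le: "1 \<le> n \<Longrightarrow> P n \<Longrightarrow> least_rank P \<le> enat n"
  by (auto simp: least_rank_def intro: Least_le)

lemma least_rank_eq_1: "P 1 \<Longrightarrow> least_rank P = 1"
  using least_rank_le[of 1 P] least_rank_eq_enatD(1)[of P]
  by (cases "least_rank P") (auto simp: one_enat_def intro: antisym)

section \<open>Tuples as lists, split at the last entry\<close>

lemma tuplesD: "f \<in> tuples R n \<Longrightarrow> j < n \<Longrightarrow> f ! j \<in> carrier R"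
  by (auto simp: tuples_def)

lemma tuples_length: "f \<in> tuples R n \<Longrightarrow> length f = n"
  by (simp add: tuples_def)

lemma tuples_snoc: "f @ [g] \<in> tuples R (Suc n) \<longleftrightarrow> f \<in> tuples R n \<and> g \<in> carrier R"
  by (auto simp: tuples_def)

lemma tuples_SucE:
  assumes "r \<in> tuples R (Suc n)"
  obtains s a where "r = s @ [a]" "s \<in> tuples R n" "a \<in> carrier R"
  using assms by (cases r rule: rev_cases) (auto simp: tuples_def)

lemma inv_tuples_subset: "inv_tuples R n \<subseteq> tuples R n"
  by (auto simp: inv_tuples_def)

lemma unitary_at_imp_bass_at: "unitary_at R n \<Longrightarrow> bass_at R n"
  using inv_tuples_subset unfolding unitary_at_def bass_at_def by blast

lemma add_mult_snoc:
  "length f = length x \<Longrightarrow>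
   add_mult R (f @ [a]) (x @ [b]) g = add_mult R f x g @ [a \<oplus>\<^bsub>R\<^esub> b \<otimes>\<^bsub>R\<^esub> g]"
  by (simp add: add_mult_def)

lemma add_mult_single: "add_mult R [a] [b] g = [a \<oplus>\<^bsub>R\<^esub> b \<otimes>\<^bsub>R\<^esub> g]"
  by (simp add: add_mult_def)

section \<open>Linear combinations and invertible tuples over a commutative ring\<close>

context cring
begin

lemma dot_closed:
  assumes "r \<in> tuples R n" "f \<in> tuples R n"
  shows "dot R r f \<in> carrier R"
  unfolding dot_def using assms by (auto intro!: finsum_closed simp: tuplesD tuples_length)

lemma dot_snoc:
  assumes "r \<in> tuples R n" "f \<in> tuples R n" "a \<in> carrier R" "g \<in> carrier R"
  shows "dot R (r @ [a]) (f @ [g]) = dot R r f \<oplus> a \<otimes> g"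
proof -
  have "(\<Oplus>j\<in>{..<n}. ((r @ [a]) ! j) \<otimes> ((f @ [g]) ! j)) = (\<Oplus>j\<in>{..<n}. (r ! j) \<otimes> (f ! j))"
    using assms by (intro finsum_cong') (auto simp: tuplesD tuples_length nth_append)
  moreover have "dot R (r @ [a]) (f @ [g]) =
      a \<otimes> g \<oplus> (\<Oplus>j\<in>{..<n}. ((r @ [a]) ! j) \<otimes> ((f @ [g]) ! j))"
    using assms
    by (auto simp: dot_def tuples_length lessThan_Suc finsum_insert nth_append tuplesD)
  ultimately show ?thesis
    using assms dot_closed[OF assms(1,2)] by (simp add: dot_def tuples_length a_comm)
qed

lemma dot_single: "c \<in> carrier R \<Longrightarrow> a \<in> carrier R \<Longrightarrow> dot R [c] [a] = c \<otimes> a"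
  using dot_snoc[of "[]" 0 "[]" c a] by (simp add: tuples_def dot_def)

lemma add_mult_closed:
  assumes "f \<in> tuples R n" "x \<in> tuples R n" "g \<in> carrier R"
  shows "add_mult R f x g \<in> tuples R n"
  using assms by (force simp: tuples_def add_mult_def set_zip)

lemma dot_add_mult:
  assumes "r \<in> tuples R n" "f \<in> tuples R n" "x \<in> tuples R n" "g \<in> carrier R"
  shows "dot R r (add_mult R f x g) = dot R r f \<oplus> dot R r x \<otimes> g"
  using assms(1-3)
proof (induction n arbitrary: r f x)
  case 0
  then show ?case using assms(4) by (simp add: tuples_def add_mult_def dot_def)
next
  case (Suc n)
  obtain r' a where r: "r = r' @ [a]" "r' \<in> tuples R n" "a \<in> carrier R"
    using tuples_SucE Suc.prems(1) by blast
  obtain f' b where f: "f = f' @ [b]" "f' \<in> tuples R n" "b \<in> carrier R"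
    using tuples_SucE Suc.prems(2) by blast
  obtain x' c where x: "x = x' @ [c]" "x' \<in> tuples R n" "c \<in> carrier R"
    using tuples_SucE Suc.prems(3) by blast
  have "dot R r' f' \<in> carrier R" "dot R r' x' \<in> carrier R"
    using r f x dot_closed by auto
  then show ?case
    using r f x assms(4) Suc.IH[OF r(2) f(2) x(2)]
    by (simp add: add_mult_snoc tuples_length dot_snoc[where n = n] add_mult_closed) algebra
qed

lemma dot_map_mult:
  assumes "r \<in> tuples R n" "y \<in> tuples R n" "b \<in> carrier R"
  shows "dot R r (map (\<lambda>v. v \<otimes> b) y) = dot R r y \<otimes> b"
proof -
  have "(\<Oplus>j\<in>{..<n}. (r ! j) \<otimes> (y ! j)) \<otimes> b = (\<Oplus>j\<in>{..<n}. (r ! j) \<otimes> (y ! j) \<otimes> b)"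
    using assms by (intro finsum_ldistr) (auto simp: tuplesD)
  also have "\<dots> = (\<Oplus>j\<in>{..<n}. (r ! j) \<otimes> (map (\<lambda>v. v \<otimes> b) y ! j))"
    using assms by (intro finsum_cong') (auto simp: tuplesD tuples_length m_assoc)
  finally show ?thesis
    using assms by (simp add: dot_def tuples_length)
qed

text \<open>If a combination of the entries equals \<one>, multiplying its coefficients by
  \<open>c\<close> yields \<open>c\<close>, so the whole ring is generated.\<close>

lemma inv_tuples_iff:
  "f \<in> inv_tuples R n \<longleftrightarrow> f \<in> tuples R n \<and> (\<exists>r\<in>tuples R n. dot R r f = \<one>)"
proof -
  have "ideal_sum R f = carrier R \<longleftrightarrow> (\<exists>r\<in>tuples R n. dot R r f = \<one>)" if f: "f \<in> tuples R n"
  proof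
    assume "ideal_sum R f = carrier R"
    then have "\<one> \<in> ideal_sum R f" by simp
    then show "\<exists>r\<in>tuples R n. dot R r f = \<one>"
      using f by (auto simp: ideal_sum_def dot_def tuples_length)
  next
    assume "\<exists>r\<in>tuples R n. dot R r f = \<one>"
    then obtain r where r: "r \<in> tuples R n" "dot R r f = \<one>" by blast
    have sum: "ideal_sum R f = {dot R s f | s. s \<in> tuples R n}"
      using f by (simp add: ideal_sum_def dot_def tuples_length)
    show "ideal_sum R f = carrier R"
    proof
      show "ideal_sum R f \<subseteq> carrier R" using sum f dot_closed by auto
    next
      show "carrier R \<subseteq> ideal_sum R f"
      proof
        fix c assume c: "c \<in> carrier R"
        let ?s = "map (\<lambda>v. v \<otimes> c) r"
        have s: "?s \<in> tuples R n" using r c by (auto simp: tuples_def)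
        \<comment> \<open>\<open>dot_map_mult\<close> scales the second argument, whereas here the
          coefficients in the first are scaled; symmetry bridges the two.\<close>
        have comm: "dot R s t = dot R t s" if "s \<in> tuples R n" "t \<in> tuples R n" for s t
          using that unfolding dot_def
          by (intro finsum_cong') (auto simp: tuplesD tuples_length m_comm)
        have "dot R ?s f = c"
          using dot_map_mult[OF f r(1) c] comm[OF f s] comm[OF f r(1)] r(2) c by simp
        with s show "c \<in> ideal_sum R f" unfolding sum by (auto intro!: exI[of _ ?s])
      qed
    qed
  qed
  then show ?thesis by (auto simp: inv_tuples_def)
qed

lemma inv_tuples_snoc_iff:
  "f @ [g] \<in> inv_tuples R (Suc n) \<longleftrightarrow> f \<in> tuples R n \<and> g \<in> carrier R \<and>
     (\<exists>r\<in>tuples R n. \<exists>a\<in>carrier R. dot R r f \<oplus> a \<otimes> g = \<one>)"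
  unfolding inv_tuples_iff tuples_snoc
  by (metis dot_snoc tuples_SucE tuples_snoc)

section \<open>From the Bass condition to the unitary condition\<close>

lemma bass_at_imp_unitary_at_Suc:
  assumes "bass_at R n"
  shows "unitary_at R (Suc n)"
  unfolding unitary_at_def
proof (intro allI impI)
  fix fp g assume "fp @ [g] \<in> inv_tuples R (Suc n + 1)"
  then obtain s b where fp: "fp \<in> tuples R (Suc n)" and g: "g \<in> carrier R"
    and s: "s \<in> tuples R (Suc n)" and b: "b \<in> carrier R" and sb: "dot R s fp \<oplus> b \<otimes> g = \<one>"
    by (auto simp: inv_tuples_snoc_iff)
  obtain f p where f: "fp = f @ [p]" "f \<in> tuples R n" and p: "p \<in> carrier R"
    using tuples_SucE fp by blast
  obtain r a where r: "s = r @ [a]" "r \<in> tuples R n" and a: "a \<in> carrier R"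
    using tuples_SucE s by blast
  \<comment> \<open>Merging the last two entries into \<open>h\<close> leaves a tuple of length
    \<open>n + 1\<close>, to which the Bass condition applies. \<open>F\<close> keeps the factor
    \<one> so that it is literally the last entry produced by \<open>add_mult_snoc\<close>.\<close>
  define h where "h = a \<otimes> p \<oplus> b \<otimes> g"
  define F where "F = p \<oplus> \<one> \<otimes> g"
  have h: "h \<in> carrier R" and F: "F \<in> carrier R"
    using a b p g by (simp_all add: h_def F_def)
  have rf: "dot R r f \<in> carrier R" using r f dot_closed by blast
  have "dot R r f \<oplus> \<one> \<otimes> h = \<one>"
    using sb rf a b p g f r by (simp add: h_def dot_snoc[where n = n] a_assoc)
  then have "f @ [h] \<in> inv_tuples R (n + 1)"
    using f r h by (simp add: inv_tuples_snoc_iff) (metis l_one one_closed)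
  then obtain y where y: "y \<in> tuples R n" "add_mult R f y h \<in> inv_tuples R n"
    using assms unfolding bass_at_def by blast
  then obtain t where t: "t \<in> tuples R n" "dot R t (add_mult R f y h) = \<one>"
    by (auto simp: inv_tuples_iff)
  define z where "z = map (\<lambda>v. v \<otimes> (b \<ominus> a)) y"
  have z: "z \<in> tuples R n" using y(1) a b by (auto simp: z_def tuples_def)
  have cl: "dot R t f \<in> carrier R" "dot R t y \<in> carrier R"
    using t f y dot_closed by auto
  \<comment> \<open>The list \<open>t\<close> certifies \<open>f + y h\<close>. As
    \<open>h = a F + (b - a) g\<close>, the part \<open>(b - a) g\<close> turns \<open>y\<close>
    into \<open>z\<close>, and the part \<open>a F\<close> supplies the coefficient of
    \<open>F\<close>.\<close>
  have "dot R t (add_mult R f z g) \<oplus> (dot R t y \<otimes> a) \<otimes> F = \<one>"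
  proof -
    have "dot R t (add_mult R f z g) = dot R t f \<oplus> dot R t y \<otimes> (b \<ominus> a) \<otimes> g"
      using t f y z g a b by (simp add: dot_add_mult[where n = n] z_def dot_map_mult[where n = n])
    moreover have "dot R t f \<oplus> dot R t y \<otimes> h = \<one>"
      using t f y h by (simp add: dot_add_mult[where n = n])
    ultimately show ?thesis
      using cl a b p g unfolding h_def F_def by algebra
  qed
  then have "add_mult R f z g @ [F] \<in> inv_tuples R (Suc n)"
    using t f z g F a cl by (auto simp: inv_tuples_snoc_iff add_mult_closed)
  then have "add_mult R fp (z @ [\<one>]) g \<in> inv_tuples R (Suc n)"
    using f z by (simp add: add_mult_snoc tuples_length F_def)
  moreover have "z @ [\<one>] \<in> inv_tuples R (Suc n)"
  proof -
    have "dot R t z \<in> carrier R" using t z dot_closed by blast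
    \<comment> \<open>Whatever the coefficients of \<open>z\<close> are, the last entry \<one> can
      correct the sum to \<one>; \<open>t\<close> merely serves as a tuple at hand.\<close>
    then have "dot R t z \<oplus> (\<one> \<ominus> dot R t z) \<otimes> \<one> = \<one>" by algebra
    then show ?thesis
      using t z \<open>dot R t z \<in> carrier R\<close> unfolding inv_tuples_snoc_iff by (metis minus_closed one_closed)
  qed
  ultimately show "\<exists>u\<in>inv_tuples R (Suc n). add_mult R fp u g \<in> inv_tuples R (Suc n)"
    by blast
qed

text \<open>Each step from \<open>m\<close> to \<open>Suc m\<close> passes through the Bass
  condition for \<open>m\<close>.\<close>

lemma unitary_at_mono:
  assumes "n \<le> m" "unitary_at R n"
  shows "unitary_at R m"
  using assms by (induction m rule: dec_induct)
    (auto intro: bass_at_imp_unitary_at_Suc unitary_at_imp_bass_at)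

lemma bsr_le_usr: "bsr R \<le> usr R"
proof (cases "usr R")
  case (enat n)
  with least_rank_eq_enatD[of "unitary_at R" n] show ?thesis
    by (simp add: bsr_eq usr_eq least_rank_le unitary_at_imp_bass_at)
qed simp

lemma usr_le_bsr_plus_1: "usr R \<le> bsr R + 1"
proof (cases "bsr R")
  case (enat n)
  with least_rank_eq_enatD[of "bass_at R" n] have "unitary_at R (Suc n)"
    by (simp add: bsr_eq bass_at_imp_unitary_at_Suc)
  then have "usr R \<le> enat (Suc n)"
    by (simp add: usr_eq least_rank_le)
  with enat show ?thesis by (simp add: one_enat_def)
qed simp

lemma inv_tuples_1_iff: "f \<in> inv_tuples R 1 \<longleftrightarrow> (\<exists>a\<in>Units R. f = [a])"
proof -
  \<comment> \<open>The empty prefix contributes \<zero>, so the certificate reduces to an inverse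
    of \<open>a\<close>.\<close>
  have "[] @ [a] \<in> inv_tuples R (Suc 0) \<longleftrightarrow> a \<in> Units R" for a
    unfolding inv_tuples_snoc_iff
    by (auto simp: tuples_def dot_def Units_def m_comm intro: m_comm)
  moreover have "f \<in> inv_tuples R 1 \<Longrightarrow> \<exists>a. f = [a]"
    by (auto simp: inv_tuples_def tuples_def length_Suc_conv)
  ultimately show ?thesis by auto
qed

lemma tuples_1_iff: "f \<in> tuples R 1 \<longleftrightarrow> (\<exists>a\<in>carrier R. f = [a])"
  by (auto simp: tuples_def length_Suc_conv)

end

section \<open>Fields: Bass stable rank one, unitary stable rank one or two\<close>

context field
begin

lemma inv_pairD:
  assumes "f @ [g] \<in> inv_tuples R (1 + 1)"
  obtains a where "f = [a]" "a \<in> carrier R" "g \<in> carrier R" "a \<noteq> \<zero> \<or> g \<noteq> \<zero>"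
proof -
  obtain a r b where *: "f = [a]" "a \<in> carrier R" "g \<in> carrier R"
    "r \<in> tuples R 1" "b \<in> carrier R" "dot R r f \<oplus> b \<otimes> g = \<one>"
    using assms tuples_1_iff by (auto simp: inv_tuples_snoc_iff)
  then obtain c where "r = [c]" "c \<in> carrier R" using tuples_1_iff by auto
  then have "a \<noteq> \<zero> \<or> g \<noteq> \<zero>"
    using * by (auto simp: dot_single)
  with * that show thesis by blast
qed

lemma inv_tuples_1_field_iff: "[a] \<in> inv_tuples R 1 \<longleftrightarrow> a \<in> carrier R \<and> a \<noteq> \<zero>"
  unfolding inv_tuples_1_iff by (auto simp: field_Units)

lemma bsr_eq_1: "bsr R = 1"
  unfolding bsr_eq
proof (rule least_rank_eq_1, unfold bass_at_def, intro allI impI)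
  fix f g assume "f @ [g] \<in> inv_tuples R (1 + 1)"
  then obtain a where a: "f = [a]" "a \<in> carrier R" "g \<in> carrier R" "a \<noteq> \<zero> \<or> g \<noteq> \<zero>"
    by (rule inv_pairD)
  \<comment> \<open>A nonzero \<open>a\<close> is left alone; otherwise the shift replaces it by
    \<open>g\<close>, which is then nonzero.\<close>
  define x where "x = (if a = \<zero> then \<one> else \<zero>)"
  have "add_mult R f [x] g \<in> inv_tuples R 1"
    using a by (auto simp: x_def add_mult_single inv_tuples_1_field_iff simp del: One_nat_def)
  moreover have "[x] \<in> tuples R 1"
    by (auto simp: x_def tuples_def)
  ultimately show "\<exists>x\<in>tuples R 1. add_mult R f x g \<in> inv_tuples R 1" by blast
qed

text \<open>A third element \<open>c\<close> gives two candidate units, \<one> and \<open>c\<close>.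
  If both shifts of \<open>a\<close> vanished, their difference \<open>(c - 1) g\<close> would too,
  forcing \<open>g = 0\<close> and then \<open>a = 0\<close>.\<close>

lemma usr_eq_1:
  assumes "carrier R \<noteq> {\<zero>, \<one>}"
  shows "usr R = 1"
  unfolding usr_eq
proof (rule least_rank_eq_1, unfold unitary_at_def, intro allI impI)
  fix f g assume "f @ [g] \<in> inv_tuples R (1 + 1)"
  then obtain a where a: "f = [a]" "a \<in> carrier R" "g \<in> carrier R" "a \<noteq> \<zero> \<or> g \<noteq> \<zero>"
    by (rule inv_pairD)
  obtain c where c: "c \<in> carrier R" "c \<noteq> \<zero>" "c \<noteq> \<one>"
    using assms by auto
  have "\<exists>u\<in>carrier R. u \<noteq> \<zero> \<and> a \<oplus> u \<otimes> g \<noteq> \<zero>"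
  proof (rule ccontr)
    assume "\<not> ?thesis"
    then have 1: "a \<oplus> \<one> \<otimes> g = \<zero>" and 2: "a \<oplus> c \<otimes> g = \<zero>"
      using c by (metis one_closed one_not_zero)+
    have "(c \<ominus> \<one>) \<otimes> g = (a \<oplus> c \<otimes> g) \<ominus> (a \<oplus> \<one> \<otimes> g)"
      using a c by algebra
    also have "\<dots> = \<zero>" unfolding 1 2 by algebra
    finally have "g = \<zero>"
      using a c integral by (metis minus_closed one_closed r_right_minus_eq)
    with 1 a show False by simp
  qed
  then show "\<exists>u\<in>inv_tuples R 1. add_mult R f u g \<in> inv_tuples R 1"
    using a by (metis add_mult_single inv_tuples_1_field_iff a_closed m_closed)
qed

lemma usr_eq_2:
  assumes "carrier R = {\<zero>, \<one>}"
  shows "usr R = 1 + 1"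
proof -
  \<comment> \<open>The other possible value \<one> would cancel to \<one> = \<zero>.\<close>
  have "\<one> \<oplus> \<one> = \<zero>"
    using assms a_closed[of \<one> \<one>] add.l_cancel_one[of \<one> \<one>] by auto
  have "\<not> unitary_at R 1"
  proof
    assume *: "unitary_at R 1"
    have "[\<zero>] \<in> tuples R 1" "[\<one>] \<in> tuples R 1" "dot R [\<zero>] [\<one>] \<oplus> \<one> \<otimes> \<one> = \<one>"
      by (simp_all add: tuples_def dot_single)
    then have "[\<one>] @ [\<one>] \<in> inv_tuples R (Suc 1)"
      unfolding inv_tuples_snoc_iff by blast
    then obtain u where u: "u \<in> inv_tuples R 1" "add_mult R [\<one>] u \<one> \<in> inv_tuples R 1"
      using * unfolding unitary_at_def by (metis Suc_eq_plus1)
    then obtain c where "u = [c]" "c \<in> Units R" using inv_tuples_1_iff by auto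
    then have "u = [\<one>]" using assms field_Units by auto
    then show False
      using u(2) \<open>\<one> \<oplus> \<one> = \<zero>\<close> by (simp add: add_mult_single inv_tuples_1_field_iff del: One_nat_def)
  qed
  then have "usr R \<noteq> enat 1"
    using least_rank_eq_enatD(2)[of "unitary_at R" 1] by (auto simp: usr_eq)
  \<comment> \<open>Since the Bass stable rank is 1, the general bounds leave only 1 and 2, and 1
    has just been excluded.\<close>
  moreover have "1 \<le> usr R" "usr R \<le> 1 + 1"
    using bsr_le_usr usr_le_bsr_plus_1 by (simp_all add: bsr_eq_1)
  ultimately show ?thesis
    by (cases "usr R") (auto simp: one_enat_def)
qed

end

text \<open>Types cannot be quantified existentially, so the examples are placed at
  \<open>int ring\<close>, where the residue rings live. Their nontriviality is asserted as well, so
  the zero ring does not serve as an example.\<close>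

theorem theorem1p2:
  "(\<forall>R :: ('a, 'm) ring_scheme. cring R \<longrightarrow>
      (\<forall>n m. usr R = enat n \<and> n \<le> m \<longrightarrow>
        (\<forall>f g. f @ [g] \<in> inv_tuples R (m + 1) \<longrightarrow>
          (\<exists>u\<in>inv_tuples R m. add_mult R f u g \<in> inv_tuples R m))) \<and>
      bsr R \<le> usr R \<and> usr R \<le> bsr R + 1) \<and>
   (\<exists>R :: int ring. cring R \<and> \<one>\<^bsub>R\<^esub> \<noteq> \<zero>\<^bsub>R\<^esub> \<and> bsr R < \<infinity> \<and> usr R = bsr R) \<and>
   (\<exists>R :: int ring. cring R \<and> \<one>\<^bsub>R\<^esub> \<noteq> \<zero>\<^bsub>R\<^esub> \<and> bsr R < \<infinity> \<and> usr R = bsr R + 1)"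
proof (intro conjI)
  have "unitary_at R m" if "cring R" "usr R = enat n" "n \<le> m" for R :: "('a, 'm) ring_scheme" and n m
    using that cring.unitary_at_mono least_rank_eq_enatD(2)[of "unitary_at R" n]
    by (auto simp: usr_eq)
  then show "\<forall>R :: ('a, 'm) ring_scheme. cring R \<longrightarrow>
      (\<forall>n m. usr R = enat n \<and> n \<le> m \<longrightarrow>
        (\<forall>f g. f @ [g] \<in> inv_tuples R (m + 1) \<longrightarrow>
          (\<exists>u\<in>inv_tuples R m. add_mult R f u g \<in> inv_tuples R m))) \<and>
      bsr R \<le> usr R \<and> usr R \<le> bsr R + 1"
    unfolding unitary_at_def using cring.bsr_le_usr cring.usr_le_bsr_plus_1 by blast
next
  \<comment> \<open>In the field with 3 elements, 2 is the element besides \<zero> and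
    \<one>.\<close>
  interpret F3: residues_prime 3 "residue_ring (int 3)"
    by unfold_locales auto
  have "(2 :: int) \<in> carrier (residue_ring (int 3))"
    by (simp add: residue_ring_def)
  moreover have "(2 :: int) \<notin> {\<zero>\<^bsub>residue_ring (int 3)\<^esub>, \<one>\<^bsub>residue_ring (int 3)\<^esub>}"
    by (simp add: residue_ring_def)
  ultimately have "carrier (residue_ring (int 3)) \<noteq> {\<zero>\<^bsub>residue_ring (int 3)\<^esub>, \<one>\<^bsub>residue_ring (int 3)\<^esub>}"
    by blast
  then have "usr (residue_ring (int 3)) = 1" "bsr (residue_ring (int 3)) = 1"
    using field.usr_eq_1[OF F3.is_field] field.bsr_eq_1[OF F3.is_field] by auto
  then show "\<exists>R :: int ring. cring R \<and> \<one>\<^bsub>R\<^esub> \<noteq> \<zero>\<^bsub>R\<^esub> \<and> bsr R < \<infinity> \<and> usr R = bsr R"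
    using F3.cring by (intro exI[of _ "residue_ring (int 3)"]) (auto simp: residue_ring_def one_enat_def)
next
  interpret F2: residues_prime 2 "residue_ring (int 2)"
    by unfold_locales auto
  have "carrier (residue_ring (int 2)) = {\<zero>\<^bsub>residue_ring (int 2)\<^esub>, \<one>\<^bsub>residue_ring (int 2)\<^esub>}"
    by (auto simp: residue_ring_def)
  then have "usr (residue_ring (int 2)) = 1 + 1" "bsr (residue_ring (int 2)) = 1"
    using field.usr_eq_2[OF F2.is_field] field.bsr_eq_1[OF F2.is_field] by auto
  then show "\<exists>R :: int ring. cring R \<and> \<one>\<^bsub>R\<^esub> \<noteq> \<zero>\<^bsub>R\<^esub> \<and> bsr R < \<infinity> \<and> usr R = bsr R + 1"
    using F2.cring by (intro exI[of _ "residue_ring (int 2)"]) (auto simp: residue_ring_def one_enat_def)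
qed

end
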